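(* Let $G=(V,E)$ be a simple connected graph, let $d(u)$ denote the degree of a vertex $u$, and let $\lambda_1(G)$ be the largest eigenvalue of the Laplacian matrix of $G$. Then $$\lambda_1(G)\le 2+\max\left\{\sqrt{(d(u)+d(v)-2)(d(u)+d(w)-2)}\right\},$$ where the maximum is taken over all pairs $(u,v),(u,w)\in E(G)$. Moreover, equality holds if and only if $G$ is a regular bipartite graph, or a semiregular graph, or a path of order four.
   Context: All graphs are simple (no loops or multiple edges). The Laplacian matrix of $G$ is $L(G)=D(G)-A(G)$, where $D(G)$ is the diagonal matrix of vertex degrees and $A(G)$ is the $(0,1)$ adjacency matrix. $(u,v)\in E(G)$ denotes the (undirected) edge joining $u$ and $v$. A semiregular graph $G=(V,E)$ is a graph with bipartition $(V_1,V_2)$ of $V$ such that all vertices in $V_i$ have the same degree $k_i$ for $i=1,2$. A path of order four is the path on four vertices. *)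

theory Defs
  imports
    Complex_Main
    "Graph_Theory.Digraph_Component"
    "Jordan_Normal_Form.Spectral_Radius"
begin

text \<open>
  A simple undirected graph is a digraph in the locale \<open>graph\<close> of \<open>Graph_Theory\<close>: finite,
  loopless, without parallel arcs and symmetric.  Each undirected edge is a pair of opposite
  arcs, \<open>arcs_ends G\<close> is the symmetric edge relation, and the degree of a vertex is its
  \<open>out_degree\<close>.  Matrices are indexed by positions in a list \<open>vs\<close> enumerating the vertices.
\<close>

definition degree_mat :: "('a, 'b) pre_digraph \<Rightarrow> 'a list \<Rightarrow> real mat" where
  "degree_mat G vs = mat_diag (length vs) (\<lambda>i. real (out_degree G (vs ! i)))"

definition adjacency_mat :: "('a, 'b) pre_digraph \<Rightarrow> 'a list \<Rightarrow> real mat" where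
  "adjacency_mat G vs = mat (length vs) (length vs)
     (\<lambda>(i, j). if (vs ! i, vs ! j) \<in> arcs_ends G then 1 else 0)"

definition laplacian_mat :: "('a, 'b) pre_digraph \<Rightarrow> 'a list \<Rightarrow> real mat" where
  "laplacian_mat G vs = degree_mat G vs - adjacency_mat G vs"

text \<open>The Laplacian is real symmetric, so its real spectrum contains all of its eigenvalues.\<close>

definition laplacian_lambda1 :: "('a, 'b) pre_digraph \<Rightarrow> 'a list \<Rightarrow> real" where
  "laplacian_lambda1 G vs = Max (spectrum (laplacian_mat G vs))"

text \<open>
  The maximum ranges over pairs of distinct edges with a common vertex \<open>u\<close>, hence \<open>v \<noteq> w\<close>
  (with \<open>v = w\<close> admitted, equality would fail for the path of order four).  All these
  square roots are nonnegative, so inserting \<open>0\<close> only matters for a connected graph with at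
  most one edge, where it sets the maximum of the empty set to \<open>0\<close>.
\<close>

definition edge_pair_max :: "('a, 'b) pre_digraph \<Rightarrow> real" where
  "edge_pair_max G = Max (insert 0
     {sqrt ((real (out_degree G u) + real (out_degree G v) - 2) *
            (real (out_degree G u) + real (out_degree G w) - 2)) | u v w.
        (u, v) \<in> arcs_ends G \<and> (u, w) \<in> arcs_ends G \<and> v \<noteq> w})"

text \<open>
  The two classes of a bipartition are nonempty; for connected graphs this only excludes the
  one-vertex graph.
\<close>

definition bipartition :: "('a, 'b) pre_digraph \<Rightarrow> 'a set \<Rightarrow> 'a set \<Rightarrow> bool" where
  "bipartition G V1 V2 \<longleftrightarrow>
     V1 \<noteq> {} \<and> V2 \<noteq> {} \<and> V1 \<inter> V2 = {} \<and> V1 \<union> V2 = verts G \<and>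
     (\<forall>(u, v) \<in> arcs_ends G. u \<in> V1 \<and> v \<in> V2 \<or> u \<in> V2 \<and> v \<in> V1)"

definition bipartite_graph :: "('a, 'b) pre_digraph \<Rightarrow> bool" where
  "bipartite_graph G \<longleftrightarrow> (\<exists>V1 V2. bipartition G V1 V2)"

definition regular_graph :: "('a, 'b) pre_digraph \<Rightarrow> bool" where
  "regular_graph G \<longleftrightarrow> (\<exists>k. \<forall>v \<in> verts G. out_degree G v = k)"

definition semiregular_graph :: "('a, 'b) pre_digraph \<Rightarrow> bool" where
  "semiregular_graph G \<longleftrightarrow>
     (\<exists>V1 V2 k1 k2. bipartition G V1 V2 \<and>
        (\<forall>v \<in> V1. out_degree G v = k1) \<and> (\<forall>v \<in> V2. out_degree G v = k2))"

definition path_order_four :: "('a, 'b) pre_digraph \<Rightarrow> bool" where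
  "path_order_four G \<longleftrightarrow>
     (\<exists>a b c d. distinct [a, b, c, d] \<and> verts G = {a, b, c, d} \<and>
        arcs_ends G = {(a, b), (b, a), (b, c), (c, b), (c, d), (d, c)})"

end

theory Submission
  imports Defs
begin

text \<open>
  The bound becomes a statement about one function on the arcs of \<open>G\<close>.  Let \<open>x\<close> be an
  eigenfunction of the Laplacian for the eigenvalue \<open>c\<close> and put \<open>y (u, v) = x u - x v\<close>.
  Since \<open>c x(u)\<close> is the sum of \<open>y\<close> over the arcs leaving \<open>u\<close> and \<open>- c x(v)\<close> is the sum of
  \<open>y\<close> over the arcs entering \<open>v\<close>, the number \<open>(c - 2) y (u, v)\<close> is the sum of \<open>y\<close> over all
  other arcs that leave \<open>u\<close> or enter \<open>v\<close> (lemma \<open>arc_diff_eigen\<close>).  There are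
  \<open>d(u) + d(v) - 2\<close> such arcs: they are the neighbours of the edge \<open>uv\<close> in the line graph,
  each with the orientation that makes all signs in this equation positive.

  Let \<open>c > 2\<close>.  Choose an arc \<open>e\<close> at which \<open>y\<close> is maximal and a neighbour \<open>f\<close> of \<open>e\<close>
  at which \<open>y\<close> is maximal among the neighbours of \<open>e\<close>.  The equations at \<open>e\<close> and \<open>f\<close> give
  \<open>(c - 2) y(e) \<le> n(e) y(f)\<close> and \<open>(c - 2) y(f) \<le> n(f) y(e)\<close>, where \<open>n\<close> counts neighbours in
  the line graph.  Multiplying, \<open>(c - 2)\<^sup>2 \<le> n(e) n(f)\<close>, which is the bound
  (\<open>neighbour_card_product\<close>, \<open>eigenvalue_le_edge_pair_max\<close>).

  If equality holds, then both estimates are equalities, so \<open>y\<close> is constant on the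
  neighbours of \<open>e\<close> and takes the value \<open>y(e)\<close> again on their neighbours
  (\<open>neighbour_card_product_tight\<close>).  Hence on everything reachable from \<open>e\<close> two positive
  values \<open>a\<close> and \<open>b\<close> alternate.  As \<open>y\<close> changes sign when an arc is reversed, no edge is
  reached in both directions, so every vertex is either a source or a sink of reached arcs,
  and \<open>G\<close> is bipartite (\<open>equality_alternating\<close>).  The eigenvalue equation now reads
  \<open>(c - 2) a = n(e) b\<close> or \<open>(c - 2) b = n(e) a\<close>.  If \<open>a = b\<close>, then \<open>d(u) + d(v)\<close> is the same
  for all edges, and \<open>G\<close> is semiregular.  If \<open>a \<noteq> b\<close>, then edges with a common vertex have
  different values and different line graph degrees; so at most two edges meet at a vertex,
  and the neighbours of a vertex have different degrees, which leaves only the path of order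
  four.

  Conversely, semiregular graphs and the path of order four have explicit eigenfunctions
  whose eigenvalue is at least the bound, hence equal to it.
\<close>

section \<open>Maxima of eigenfunctions of a neighbourhood sum\<close>

text \<open>
  The two one-sided estimates at a maximum \<open>e\<close> and at the best neighbour \<open>f\<close> of \<open>e\<close>: each
  sum is at most the number of its terms times its largest term.  Values are compared without
  absolute values, which suffices because \<open>y e > 0\<close> forces \<open>y f > 0\<close>.
\<close>

lemma best_neighbour:
  fixes y :: "'e \<Rightarrow> real" and N :: "'e \<Rightarrow> 'e set"
  assumes fin: "\<And>f. finite (N f)" and e: "e \<in> A"
    and eq: "\<And>f. f \<in> A \<Longrightarrow> m * y f = (\<Sum>g\<in>N f. y g)"
    and max: "\<And>f. f \<in> A \<Longrightarrow> y f \<le> y e"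
    and clos: "\<And>f. f \<in> A \<Longrightarrow> N f \<subseteq> A"
    and pos: "m > 0" "y e > 0"
  obtains f where "f \<in> N e" "\<And>g. g \<in> N e \<Longrightarrow> y g \<le> y f" "y f > 0"
    "m * y e \<le> real (card (N e)) * y f" "m * y f \<le> real (card (N f)) * y e"
proof -
  have mye: "0 < m * y e" using pos by simp
  then have ne: "N e \<noteq> {}" using eq[OF e] by auto
  have "Max (y ` N e) \<in> y ` N e" using fin ne by simp
  then obtain f where f: "f \<in> N e" "y f = Max (y ` N e)" by (metis imageE)
  then have fmax: "y g \<le> y f" if "g \<in> N e" for g
    using that fin by simp
  have 1: "m * y e \<le> real (card (N e)) * y f"
    using sum_bounded_above[of "N e" y "y f"] fmax eq[OF e] by simp
  then have "0 < real (card (N e)) * y f" using mye by linarith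
  then have yf: "y f > 0" by (simp add: zero_less_mult_iff)
  have fA: "f \<in> A" using f clos[OF e] by auto
  have 2: "m * y f \<le> real (card (N f)) * y e"
    using sum_bounded_above[of "N f" y "y e"] max clos[OF fA] eq[OF fA] by fastforce
  show thesis using that f(1) fmax yf 1 2 by blast
qed

lemma sum_eq_bound_imp_eq:
  fixes y :: "'e \<Rightarrow> real"
  assumes "finite S" "\<And>g. g \<in> S \<Longrightarrow> y g \<le> b" "(\<Sum>g\<in>S. y g) = real (card S) * b" "g \<in> S"
  shows "y g = b"
proof -
  have "(\<Sum>g\<in>S. b - y g) = 0" using assms by (simp add: sum_subtractf)
  then have "\<forall>g\<in>S. b - y g = 0" using assms by (subst (asm) sum_nonneg_eq_0_iff) auto
  then show ?thesis using assms by auto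
qed

text \<open>
  This is the estimate of the spectral radius of a graph by the largest geometric mean
  \<open>\<surd>(d(e) d(f))\<close> over adjacent vertices; here the graph is given by its neighbourhoods \<open>N\<close>.
\<close>

lemma neighbour_card_product:
  fixes y :: "'e \<Rightarrow> real" and N :: "'e \<Rightarrow> 'e set"
  assumes fin: "\<And>f. finite (N f)" and e: "e \<in> A"
    and clos: "\<And>f. f \<in> A \<Longrightarrow> N f \<subseteq> A"
    and eq: "\<And>f. f \<in> A \<Longrightarrow> m * y f = (\<Sum>g\<in>N f. y g)"
    and max: "\<And>f. f \<in> A \<Longrightarrow> y f \<le> y e"
    and pos: "m > 0" "y e > 0"
  obtains f where "f \<in> N e" "m\<^sup>2 \<le> real (card (N e)) * real (card (N f))"
proof -
  obtain f where f: "f \<in> N e"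
    "m * y e \<le> real (card (N e)) * y f" "m * y f \<le> real (card (N f)) * y e"
    using best_neighbour[OF fin e eq max clos pos] by metis
  have "m\<^sup>2 * y e = m * (m * y e)" by (simp add: power2_eq_square)
  also have "\<dots> \<le> m * (real (card (N e)) * y f)" using f pos by (intro mult_left_mono) auto
  also have "\<dots> = real (card (N e)) * (m * y f)" by simp
  also have "\<dots> \<le> real (card (N e)) * (real (card (N f)) * y e)" using f by (intro mult_left_mono) auto
  finally have "m\<^sup>2 * y e \<le> (real (card (N e)) * real (card (N f))) * y e" by (simp add: mult.assoc)
  then have "m\<^sup>2 \<le> real (card (N e)) * real (card (N f))" using pos by simp
  then show thesis using that f by blast
qed

text \<open>
  When \<open>m\<^sup>2\<close> is already the largest product around \<open>e\<close>, the estimates of \<open>best_neighbour\<close>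
  are equalities.  Equality at \<open>e\<close> makes every neighbour of \<open>e\<close> a best neighbour, and then
  equality at each of these neighbours makes all their neighbours maxima.
\<close>

lemma neighbour_card_product_tight:
  fixes y :: "'e \<Rightarrow> real" and N :: "'e \<Rightarrow> 'e set"
  assumes fin: "\<And>f. finite (N f)" and e: "e \<in> A"
    and clos: "\<And>f. f \<in> A \<Longrightarrow> N f \<subseteq> A"
    and eq: "\<And>f. f \<in> A \<Longrightarrow> m * y f = (\<Sum>g\<in>N f. y g)"
    and max: "\<And>f. f \<in> A \<Longrightarrow> y f \<le> y e"
    and pos: "m > 0" "y e > 0"
    and bound: "\<And>f. f \<in> N e \<Longrightarrow> real (card (N e)) * real (card (N f)) \<le> m\<^sup>2"
  obtains b where "b > 0" "\<And>f. f \<in> N e \<Longrightarrow> y f = b"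
    "\<And>f g. f \<in> N e \<Longrightarrow> g \<in> N f \<Longrightarrow> y g = y e"
proof -
  obtain f0 where f0: "f0 \<in> N e" "\<And>g. g \<in> N e \<Longrightarrow> y g \<le> y f0" "y f0 > 0"
    "m * y e \<le> real (card (N e)) * y f0" "m * y f0 \<le> real (card (N f0)) * y e"
    using best_neighbour[OF fin e eq max clos pos] by metis
  let ?c = "real (card (N e))"
  have cpos: "?c > 0" using f0(1) fin card_gt_0_iff by (metis empty_iff of_nat_0_less_iff)
  have up: "?c * (m * y f) \<le> m * (m * y e)" if "f \<in> N e" "m * y f \<le> real (card (N f)) * y e" for f
  proof -
    have "?c * (m * y f) \<le> ?c * (real (card (N f)) * y e)" using that by (intro mult_left_mono) auto
    also have "\<dots> \<le> m\<^sup>2 * y e" using mult_right_mono[OF bound[OF that(1)], of "y e"] pos by (simp add: mult.assoc)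
    finally show ?thesis by (simp add: power2_eq_square mult.assoc)
  qed
  have "m * (?c * y f0) \<le> m * (m * y e)" using up[OF f0(1,5)] by (simp add: mult.left_commute)
  then have c1: "m * y e = ?c * y f0" using f0(4) pos by simp
  have all: "y f = y f0" if "f \<in> N e" for f
    by (rule sum_eq_bound_imp_eq[OF fin f0(2)]) (use that c1 eq[OF e] in auto)
  have "y g = y e" if f: "f \<in> N e" and g: "g \<in> N f" for f g
  proof (rule sum_eq_bound_imp_eq[OF fin _ _ g])
    have fA: "f \<in> A" using f clos[OF e] by auto
    show *: "y g \<le> y e" if "g \<in> N f" for g using that max clos[OF fA] by auto
    have le: "m * y f \<le> real (card (N f)) * y e"
      using sum_bounded_above[of "N f" y "y e"] * eq[OF fA] by simp
    have "?c * (real (card (N f)) * y e) \<le> m\<^sup>2 * y e"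
      using mult_right_mono[OF bound[OF f], of "y e"] pos by (simp add: mult.assoc)
    also have "\<dots> = ?c * (m * y f)" using c1 all[OF f] by (simp add: power2_eq_square algebra_simps)
    finally have "real (card (N f)) * y e \<le> m * y f" using cpos by simp
    then show "(\<Sum>g\<in>N f. y g) = real (card (N f)) * y e" using le eq[OF fA] by simp
  qed
  then show thesis using that[of "y f0"] all f0(3) by blast
qed

section \<open>Connected graphs and the Laplacian\<close>

locale connected_graph = graph G for G :: "('a, 'b) pre_digraph" (structure) +
  assumes conn: "Digraph_Component.connected G"
begin

abbreviation nbrs :: "'a \<Rightarrow> 'a set" where
  "nbrs u \<equiv> {v. u \<rightarrow>\<^bsub>G\<^esub> v}"

abbreviation deg :: "'a \<Rightarrow> nat" where
  "deg u \<equiv> out_degree G u"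

lemma adj_sym: "u \<rightarrow>\<^bsub>G\<^esub> v \<Longrightarrow> v \<rightarrow>\<^bsub>G\<^esub> u"
  using arcs_ends_symmetric sym_arcs by metis

lemma adj_commute: "u \<rightarrow>\<^bsub>G\<^esub> v \<longleftrightarrow> v \<rightarrow>\<^bsub>G\<^esub> u"
  using adj_sym by blast

lemma adj_irrefl: "\<not> u \<rightarrow>\<^bsub>G\<^esub> u"
  using adj_not_same by blast

lemma finite_nbrs: "finite (nbrs u)"
  by (rule finite_subset[OF _ finite_verts]) (auto dest: adj_in_verts)

lemma finite_arcs_ends: "finite (arcs_ends G)"
  unfolding arcs_ends_def by simp

lemma out_degree_eq_card_nbrs: "deg u = card (nbrs u)"
proof -
  have "inj_on (head G) (out_arcs G u)"
    by (rule inj_onI) (auto intro: no_multi_arcs simp: arc_to_ends_def)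
  moreover have "head G ` out_arcs G u = nbrs u"
    by (auto simp: arcs_ends_conv image_iff)
  ultimately show ?thesis unfolding out_degree_def by (metis card_image)
qed

lemma out_degree_pos: "u \<rightarrow>\<^bsub>G\<^esub> v \<Longrightarrow> deg u > 0"
  unfolding out_degree_eq_card_nbrs card_gt_0_iff using finite_nbrs by blast

lemma verts_nonempty: "verts G \<noteq> {}"
  using conn by (simp add: connected_conv)

lemma reachable_verts: "u \<in> verts G \<Longrightarrow> v \<in> verts G \<Longrightarrow> u \<rightarrow>\<^sup>* v"
  using symmetric_connected_imp_strongly_connected[OF sym_arcs conn] by auto

text \<open>Connectedness enters every global conclusion below in this form.\<close>

lemma verts_subset_closed:
  assumes "u0 \<in> S" "u0 \<in> verts G" "\<And>u v. u \<in> S \<Longrightarrow> u \<rightarrow>\<^bsub>G\<^esub> v \<Longrightarrow> v \<in> S"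
  shows "verts G \<subseteq> S"
proof
  fix v assume "v \<in> verts G"
  then have "u0 \<rightarrow>\<^sup>* v" using reachable_verts assms by blast
  then show "v \<in> S" by (induct rule: reachable_induct) (use assms in auto)
qed

lemma ex_neighbour:
  assumes "u \<in> verts G" "w \<in> verts G" "u \<noteq> w"
  shows "\<exists>v. u \<rightarrow>\<^bsub>G\<^esub> v"
  using verts_subset_closed[of u "{u}"] assms by auto

text \<open>
  Eigenvectors of the Laplacian matrix, written as functions on the vertices, so that the
  enumeration \<open>vs\<close> disappears and the row sums become differences along arcs.
\<close>

definition laplacian_eigenfunction :: "real \<Rightarrow> ('a \<Rightarrow> real) \<Rightarrow> bool" where
  "laplacian_eigenfunction c x \<longleftrightarrow>
     (\<exists>u\<in>verts G. x u \<noteq> 0) \<and> (\<forall>u\<in>verts G. c * x u = (\<Sum>v\<in>nbrs u. x u - x v))"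

lemma laplacian_mult_vec:
  assumes "distinct vs" "set vs = verts G" "i < length vs"
  shows "(laplacian_mat G vs *\<^sub>v vec (length vs) (\<lambda>i. x (vs ! i))) $ i
    = (\<Sum>v\<in>nbrs (vs ! i). x (vs ! i) - x v)"
proof -
  let ?n = "length vs" and ?u = "vs ! i"
  have bij: "bij_betw ((!) vs) {..<?n} (verts G)"
    using bij_betw_nth[OF assms(1) refl assms(2)[symmetric]] .
  have u: "?u \<in> verts G" using assms(2) nth_mem[OF assms(3)] by simp
  have ij: "vs ! j = ?u \<longleftrightarrow> j = i" if "j < ?n" for j
    using nth_eq_iff_index_eq[OF assms(1) that assms(3)] .
  have "(laplacian_mat G vs *\<^sub>v vec ?n (\<lambda>i. x (vs ! i))) $ i
    = (\<Sum>j<?n. ((if i = j then real (deg ?u) else 0)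
                - (if ?u \<rightarrow>\<^bsub>G\<^esub> vs ! j then 1 else 0)) * x (vs ! j))"
    using assms(3) unfolding laplacian_mat_def degree_mat_def adjacency_mat_def
    by (simp add: scalar_prod_def mat_diag_def atLeast0LessThan, intro sum.cong) simp_all
  also have "\<dots> = (\<Sum>j<?n. (\<lambda>v. ((if v = ?u then real (deg ?u) else 0)
                - (if ?u \<rightarrow>\<^bsub>G\<^esub> v then 1 else 0)) * x v) (vs ! j))"
    by (rule sum.cong) (simp_all add: ij)
  also have "\<dots> = (\<Sum>v\<in>verts G. ((if v = ?u then real (deg ?u) else 0)
                - (if ?u \<rightarrow>\<^bsub>G\<^esub> v then 1 else 0)) * x v)"
    by (rule sum.reindex_bij_betw[OF bij])
  also have "\<dots> = (\<Sum>v\<in>verts G. if v = ?u then real (deg ?u) * x ?u else 0)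
                - (\<Sum>v\<in>verts G. if ?u \<rightarrow>\<^bsub>G\<^esub> v then x v else 0)"
    unfolding sum_subtractf[symmetric] by (rule sum.cong) (simp_all add: left_diff_distrib)
  also have "(\<Sum>v\<in>verts G. if v = ?u then real (deg ?u) * x ?u else 0) = real (deg ?u) * x ?u"
    using u by simp
  also have "(\<Sum>v\<in>verts G. if ?u \<rightarrow>\<^bsub>G\<^esub> v then x v else 0) = (\<Sum>v\<in>nbrs ?u. x v)"
  proof -
    have "{v \<in> verts G. ?u \<rightarrow>\<^bsub>G\<^esub> v} = nbrs ?u" using adj_in_verts by blast
    then show ?thesis using sum.inter_filter[OF finite_verts, of x "\<lambda>v. ?u \<rightarrow>\<^bsub>G\<^esub> v"] by simp
  qed
  finally show ?thesis by (simp add: sum_subtractf out_degree_eq_card_nbrs)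
qed

lemma eigenvalue_laplacian_iff:
  assumes "distinct vs" "set vs = verts G"
  shows "eigenvalue (laplacian_mat G vs) c \<longleftrightarrow> (\<exists>x. laplacian_eigenfunction c x)"
proof -
  let ?n = "length vs" and ?L = "laplacian_mat G vs"
  have dim: "dim_row ?L = ?n" by (simp add: laplacian_mat_def adjacency_mat_def)
  have key: "eigenvector ?L (vec ?n (\<lambda>i. x (vs ! i))) c \<longleftrightarrow> laplacian_eigenfunction c x" for x
  proof -
    have nz: "vec ?n (\<lambda>i. x (vs ! i)) \<noteq> 0\<^sub>v ?n \<longleftrightarrow> (\<exists>u\<in>verts G. x u \<noteq> 0)"
      unfolding vec_eq_iff assms(2)[symmetric] by (auto simp: in_set_conv_nth Bex_def)
    have "?L *\<^sub>v vec ?n (\<lambda>i. x (vs ! i)) = c \<cdot>\<^sub>v vec ?n (\<lambda>i. x (vs ! i))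
      \<longleftrightarrow> (\<forall>i<?n. (\<Sum>v\<in>nbrs (vs ! i). x (vs ! i) - x v) = c * x (vs ! i))"
      unfolding vec_eq_iff using laplacian_mult_vec[OF assms] dim by auto
    also have "\<dots> \<longleftrightarrow> (\<forall>u\<in>verts G. c * x u = (\<Sum>v\<in>nbrs u. x u - x v))"
      unfolding assms(2)[symmetric] all_set_conv_all_nth by metis
    finally show ?thesis unfolding eigenvector_def laplacian_eigenfunction_def dim nz by simp
  qed
  show ?thesis
  proof
    assume "eigenvalue ?L c"
    then obtain w where w: "eigenvector ?L w c" by (auto simp: eigenvalue_def)
    define x where "x u = w $ inv_into {..<?n} ((!) vs) u" for u
    have "inj_on ((!) vs) {..<?n}" using inj_on_nth[OF assms(1)] by simp
    then have "w = vec ?n (\<lambda>i. x (vs ! i))"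
      using w by (intro eq_vecI) (auto simp: eigenvector_def dim x_def inv_into_f_f)
    then show "\<exists>x. laplacian_eigenfunction c x" using w key by metis
  qed (use key in \<open>auto simp: eigenvalue_def\<close>)
qed

text \<open>
  The maximum of the spectrum is a genuine one because constant functions are eigenfunctions
  for \<open>0\<close>, so the real spectrum is nonempty.
\<close>

lemma laplacian_lambda1_greatest:
  assumes "distinct vs" "set vs = verts G"
  shows "\<exists>x. laplacian_eigenfunction (laplacian_lambda1 G vs) x"
    and "laplacian_eigenfunction c x \<Longrightarrow> c \<le> laplacian_lambda1 G vs"
proof -
  let ?S = "spectrum (laplacian_mat G vs)"
  have S: "?S = {c. \<exists>x. laplacian_eigenfunction c x}"
    unfolding spectrum_def eigenvalue_laplacian_iff[OF assms] by simp
  have "laplacian_mat G vs \<in> carrier_mat (length vs) (length vs)"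
    by (auto simp: laplacian_mat_def adjacency_mat_def degree_mat_def)
  then have fin: "finite ?S" by (rule card_finite_spectrum)
  have "laplacian_eigenfunction 0 (\<lambda>_. 1)"
    using verts_nonempty by (auto simp: laplacian_eigenfunction_def)
  then have "?S \<noteq> {}" unfolding S by blast
  then have "Max ?S \<in> ?S" using fin by simp
  then show "\<exists>x. laplacian_eigenfunction (laplacian_lambda1 G vs) x"
    unfolding laplacian_lambda1_def S by simp
  show "c \<le> laplacian_lambda1 G vs" if "laplacian_eigenfunction c x"
    unfolding laplacian_lambda1_def by (rule Max_ge[OF fin]) (use that S in auto)
qed

section \<open>The eigenvalue equation on the line graph\<close>

text \<open>
  The neighbours of an edge in the line graph, oriented coherently with the arc \<open>(u, v)\<close>:
  they share its tail or share its head.  With this orientation the eigenvalue equation for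
  \<open>arc_diff\<close> has no negative terms.
\<close>

fun line_nbrs :: "'a \<times> 'a \<Rightarrow> ('a \<times> 'a) set" where
  "line_nbrs (u, v) = (\<lambda>w. (u, w)) ` (nbrs u - {v}) \<union> (\<lambda>w. (w, v)) ` (nbrs v - {u})"

lemma finite_line_nbrs: "finite (line_nbrs e)"
  by (cases e) (simp add: finite_nbrs)

lemma line_nbrs_arcs: "e \<in> arcs_ends G \<Longrightarrow> line_nbrs e \<subseteq> arcs_ends G"
  by (cases e) (auto simp: adj_commute)

lemma line_nbrs_sym: "e \<in> arcs_ends G \<Longrightarrow> f \<in> line_nbrs e \<Longrightarrow> e \<in> line_nbrs f"
  by (cases e) (auto simp: image_iff adj_commute)

lemma sum_line_nbrs:
  fixes y :: "'a \<times> 'a \<Rightarrow> real"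
  assumes "u \<rightarrow>\<^bsub>G\<^esub> v"
  shows "(\<Sum>f\<in>line_nbrs (u, v). y f)
    = (\<Sum>w\<in>nbrs u. y (u, w)) + (\<Sum>w\<in>nbrs v. y (w, v)) - 2 * y (u, v)"
proof -
  have "(\<Sum>f\<in>line_nbrs (u, v). y f)
    = (\<Sum>f\<in>(\<lambda>w. (u, w)) ` (nbrs u - {v}). y f) + (\<Sum>f\<in>(\<lambda>w. (w, v)) ` (nbrs v - {u}). y f)"
    by (simp only: line_nbrs.simps, rule sum.union_disjoint) (auto simp: finite_nbrs)
  also have "\<dots> = (\<Sum>w\<in>nbrs u - {v}. y (u, w)) + (\<Sum>w\<in>nbrs v - {u}. y (w, v))"
    by (simp add: sum.reindex inj_on_def)
  finally show ?thesis
    using assms adj_sym[OF assms] by (simp add: sum_diff1 finite_nbrs)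
qed

lemma card_line_nbrs:
  assumes "u \<rightarrow>\<^bsub>G\<^esub> v"
  shows "real (card (line_nbrs (u, v))) = real (deg u) + real (deg v) - 2"
  using sum_line_nbrs[OF assms, of "\<lambda>_. 1"] by (simp add: out_degree_eq_card_nbrs)

definition arc_diff :: "('a \<Rightarrow> real) \<Rightarrow> 'a \<times> 'a \<Rightarrow> real" where
  "arc_diff x e = x (fst e) - x (snd e)"

lemma arc_diff_flip: "arc_diff x (v, u) = - arc_diff x (u, v)"
  by (simp add: arc_diff_def)

text \<open>
  Subtract the eigenvalue equations at the ends of the arc; the arc itself occurs in both
  sums, which accounts for the \<open>2\<close>.
\<close>

lemma arc_diff_eigen:
  assumes "laplacian_eigenfunction c x" "e \<in> arcs_ends G"
  shows "(c - 2) * arc_diff x e = (\<Sum>f\<in>line_nbrs e. arc_diff x f)"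
proof -
  obtain u v where e: "e = (u, v)" by fastforce
  with assms have uv: "u \<rightarrow>\<^bsub>G\<^esub> v" by simp
  then have "u \<in> verts G" "v \<in> verts G" using adj_in_verts by auto
  then have "c * x u = (\<Sum>w\<in>nbrs u. arc_diff x (u, w))" "c * x v = - (\<Sum>w\<in>nbrs v. arc_diff x (w, v))"
    using assms by (auto simp: laplacian_eigenfunction_def arc_diff_def sum_subtractf)
  then show ?thesis
    unfolding e sum_line_nbrs[OF uv] by (simp add: arc_diff_def algebra_simps)
qed

text \<open>
  A nonconstant eigenfunction differs along some arc, and reversing that arc if necessary
  makes the difference positive.
\<close>

lemma max_arc:
  assumes "laplacian_eigenfunction c x" "c \<noteq> 0"
  obtains e where "e \<in> arcs_ends G" "arc_diff x e > 0"
    "\<And>f. f \<in> arcs_ends G \<Longrightarrow> arc_diff x f \<le> arc_diff x e"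
proof -
  obtain u where u: "u \<in> verts G" "x u \<noteq> 0" using assms by (auto simp: laplacian_eigenfunction_def)
  then have "(\<Sum>v\<in>nbrs u. arc_diff x (u, v)) \<noteq> 0"
    using assms by (auto simp: laplacian_eigenfunction_def arc_diff_def)
  then obtain v where v: "u \<rightarrow>\<^bsub>G\<^esub> v" "arc_diff x (u, v) \<noteq> 0"
    by (metis (mono_tags, lifting) mem_Collect_eq sum.neutral)
  have "Max (arc_diff x ` arcs_ends G) \<in> arc_diff x ` arcs_ends G"
    using finite_arcs_ends v by (intro Max_in) auto
  then obtain e where e: "e \<in> arcs_ends G" "arc_diff x e = Max (arc_diff x ` arcs_ends G)"
    by (metis imageE)
  then have max: "arc_diff x f \<le> arc_diff x e" if "f \<in> arcs_ends G" for f
    using that finite_arcs_ends by simp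
  have "arc_diff x (u, v) \<le> arc_diff x e" "- arc_diff x (u, v) \<le> arc_diff x e"
    using max[OF v(1)] max[OF adj_sym[OF v(1)]] arc_diff_flip[of x v u] by simp_all
  then have "arc_diff x e > 0" using v by linarith
  then show thesis using that e(1) max by blast
qed

lemma finite_edge_pairs:
  "finite {f u v w | u v w. u \<rightarrow>\<^bsub>G\<^esub> v \<and> u \<rightarrow>\<^bsub>G\<^esub> w \<and> v \<noteq> w}"
proof (rule finite_subset)
  show "{f u v w | u v w. u \<rightarrow>\<^bsub>G\<^esub> v \<and> u \<rightarrow>\<^bsub>G\<^esub> w \<and> v \<noteq> w}
    \<subseteq> (\<lambda>((u, v), (u', w)). f u v w) ` (arcs_ends G \<times> arcs_ends G)" by force
qed (simp add: finite_arcs_ends)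

lemma edge_pair_max_nonneg: "edge_pair_max G \<ge> 0"
  unfolding edge_pair_max_def by (rule Max_ge) (simp_all add: finite_edge_pairs)

lemma edge_pair_max_upper:
  assumes "u \<rightarrow>\<^bsub>G\<^esub> v" "u \<rightarrow>\<^bsub>G\<^esub> w" "v \<noteq> w"
  shows "sqrt ((real (deg u) + real (deg v) - 2) * (real (deg u) + real (deg w) - 2)) \<le> edge_pair_max G"
  unfolding edge_pair_max_def by (rule Max_ge) (simp add: finite_edge_pairs, use assms in blast)

lemma edge_pair_max_least:
  assumes "c \<ge> 0" "\<And>u v w. u \<rightarrow>\<^bsub>G\<^esub> v \<Longrightarrow> u \<rightarrow>\<^bsub>G\<^esub> w \<Longrightarrow> v \<noteq> w \<Longrightarrow>
    sqrt ((real (deg u) + real (deg v) - 2) * (real (deg u) + real (deg w) - 2)) \<le> c"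
  shows "edge_pair_max G \<le> c"
  unfolding edge_pair_max_def
proof (rule Max.boundedI)
qed (use assms in \<open>auto simp: finite_edge_pairs\<close>)

lemma card_product_le_edge_pair_max:
  assumes "e \<in> arcs_ends G" "f \<in> line_nbrs e"
  shows "real (card (line_nbrs e)) * real (card (line_nbrs f)) \<le> (edge_pair_max G)\<^sup>2"
proof -
  obtain u v where e: "e = (u, v)" by fastforce
  with assms have uv: "u \<rightarrow>\<^bsub>G\<^esub> v" by simp
  from assms(2) consider
      w where "f = (u, w)" "u \<rightarrow>\<^bsub>G\<^esub> w" "w \<noteq> v" | w where "f = (w, v)" "v \<rightarrow>\<^bsub>G\<^esub> w" "w \<noteq> u"
    unfolding e by auto
  then have "sqrt (real (card (line_nbrs e)) * real (card (line_nbrs f))) \<le> edge_pair_max G"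
  proof cases
    case 1
    then show ?thesis
      using edge_pair_max_upper[OF uv 1(2)] card_line_nbrs[OF uv] card_line_nbrs[OF 1(2)] e by simp
  next
    case 2
    then show ?thesis
      using edge_pair_max_upper[OF adj_sym[OF uv] 2(2)] card_line_nbrs[OF uv]
        card_line_nbrs[OF adj_sym[OF 2(2)]] e by (simp add: add.commute)
  qed
  then show ?thesis by (metis sqrt_le_D)
qed

lemma eigenvalue_le_edge_pair_max:
  assumes x: "laplacian_eigenfunction c x"
  shows "c \<le> 2 + edge_pair_max G"
proof (cases "c \<le> 2")
  case True
  then show ?thesis using edge_pair_max_nonneg by linarith
next
  case False
  then obtain e where e: "e \<in> arcs_ends G" "arc_diff x e > 0"
    "\<And>f. f \<in> arcs_ends G \<Longrightarrow> arc_diff x f \<le> arc_diff x e"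
    using max_arc[OF x] by auto
  obtain f where f: "f \<in> line_nbrs e"
    "(c - 2)\<^sup>2 \<le> real (card (line_nbrs e)) * real (card (line_nbrs f))"
    by (rule neighbour_card_product[of line_nbrs e "arcs_ends G" "c - 2" "arc_diff x"])
      (use finite_line_nbrs e line_nbrs_arcs arc_diff_eigen[OF x] False in auto)
  then have "(c - 2)\<^sup>2 \<le> (edge_pair_max G)\<^sup>2"
    using card_product_le_edge_pair_max[OF e(1)] by fastforce
  then have "c - 2 \<le> edge_pair_max G"
    using edge_pair_max_nonneg by (rule power2_le_imp_le)
  then show ?thesis by simp
qed

section \<open>The extremal graphs attain the bound\<close>

lemma bipartitionD:
  assumes "bipartition G V1 V2" "u \<rightarrow>\<^bsub>G\<^esub> v"
  shows "u \<in> V1 \<longleftrightarrow> v \<in> V2" "u \<in> V2 \<longleftrightarrow> v \<in> V1"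
  using assms unfolding bipartition_def by blast+

text \<open>
  It suffices to find an eigenvalue that is not below the bound, since
  \<open>eigenvalue_le_edge_pair_max\<close> gives the other inequality.
\<close>

lemma semiregular_attains:
  assumes "semiregular_graph G"
  shows "\<exists>c x. laplacian_eigenfunction c x \<and> 2 + edge_pair_max G \<le> c"
proof -
  obtain V1 V2 k1 k2 where bip: "bipartition G V1 V2"
    and k1: "\<And>v. v \<in> V1 \<Longrightarrow> deg v = k1" and k2: "\<And>v. v \<in> V2 \<Longrightarrow> deg v = k2"
    using assms unfolding semiregular_graph_def by blast
  have V: "V1 \<union> V2 = verts G" "V1 \<inter> V2 = {}" using bip by (auto simp: bipartition_def)
  obtain u1 u2 where u: "u1 \<in> V1" "u2 \<in> V2" using bip by (auto simp: bipartition_def)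
  then have "u1 \<in> verts G" "u2 \<in> verts G" "u1 \<noteq> u2" using V by auto
  then obtain v1 v2 where "u1 \<rightarrow>\<^bsub>G\<^esub> v1" "u2 \<rightarrow>\<^bsub>G\<^esub> v2" using ex_neighbour by metis
  then have pos: "k1 > 0" "k2 > 0" using out_degree_pos k1 k2 u by metis+
  \<comment> \<open>Along every arc \<open>x\<close> changes by \<open>k1 + k2\<close>, so its Laplacian at \<open>u\<close> is this number times
    the signed degree of \<open>u\<close>, which is \<open>x u\<close> itself.\<close>
  define x where "x u = (if u \<in> V1 then real k1 else - real k2)" for u
  have "laplacian_eigenfunction (real k1 + real k2) x"
    unfolding laplacian_eigenfunction_def
  proof (intro conjI ballI)
    show "\<exists>u\<in>verts G. x u \<noteq> 0" using pos \<open>u1 \<in> verts G\<close> u by (auto simp: x_def)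
    fix u assume "u \<in> verts G"
    then consider "u \<in> V1" | "u \<in> V2" using V by auto
    then show "(real k1 + real k2) * x u = (\<Sum>v\<in>nbrs u. x u - x v)"
    proof cases
      case 1
      then have "(\<Sum>v\<in>nbrs u. x u - x v) = (\<Sum>v\<in>nbrs u. real k1 + real k2)"
        using bipartitionD[OF bip] V by (intro sum.cong) (auto simp: x_def)
      then show ?thesis using 1 k1 by (simp add: out_degree_eq_card_nbrs x_def)
    next
      case 2
      then have "(\<Sum>v\<in>nbrs u. x u - x v) = (\<Sum>v\<in>nbrs u. - real k2 - real k1)"
        using bipartitionD[OF bip] V by (intro sum.cong) (auto simp: x_def)
      moreover have "u \<notin> V1" using 2 V by auto
      ultimately show ?thesis using 2 k2 by (simp add: out_degree_eq_card_nbrs x_def algebra_simps)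
    qed
  qed
  moreover have "edge_pair_max G \<le> real k1 + real k2 - 2"
  proof (rule edge_pair_max_least)
    show "0 \<le> real k1 + real k2 - 2" using pos by linarith
    fix u v w assume uvw: "u \<rightarrow>\<^bsub>G\<^esub> v" "u \<rightarrow>\<^bsub>G\<^esub> w"
    have "real (deg u) + real (deg t) = real k1 + real k2" if "u \<rightarrow>\<^bsub>G\<^esub> t" for t
    proof -
      have "u \<in> V1 \<or> u \<in> V2" using adj_in_verts(1)[OF that] V by auto
      then show ?thesis using bipartitionD[OF bip that] k1 k2 by auto
    qed
    then show "sqrt ((real (deg u) + real (deg v) - 2) * (real (deg u) + real (deg w) - 2))
      \<le> real k1 + real k2 - 2" using uvw pos by simp
  qed
  ultimately show ?thesis by force
qed

lemma regular_bipartite_imp_semiregular: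
  assumes "regular_graph G" "bipartite_graph G"
  shows "semiregular_graph G"
proof -
  obtain k V1 V2 where k: "\<forall>v\<in>verts G. deg v = k" and bip: "bipartition G V1 V2"
    using assms unfolding regular_graph_def bipartite_graph_def by blast
  have "V1 \<subseteq> verts G" "V2 \<subseteq> verts G" using bip by (auto simp: bipartition_def)
  then show ?thesis unfolding semiregular_graph_def using bip k by blast
qed

lemma path_order_four_attains:
  assumes "path_order_four G"
  shows "\<exists>c x. laplacian_eigenfunction c x \<and> 2 + edge_pair_max G \<le> c"
proof -
  obtain p q r s where dist: "distinct [p, q, r, s]" and V: "verts G = {p, q, r, s}"
    and E: "arcs_ends G = {(p, q), (q, p), (q, r), (r, q), (r, s), (s, r)}"
    using assms unfolding path_order_four_def by metis
  have N: "nbrs p = {q}" "nbrs q = {p, r}" "nbrs r = {q, s}" "nbrs s = {r}"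
    using dist unfolding E by auto
  have D: "deg p = 1" "deg q = 2" "deg r = 2" "deg s = 1"
    using dist unfolding out_degree_eq_card_nbrs N by auto
  let ?c = "2 + sqrt 2"
  define x where "x = (\<lambda>u. 0 :: real)(p := 1, q := - (1 + sqrt 2), r := 1 + sqrt 2, s := - 1)"
  have x: "x p = 1" "x q = - (1 + sqrt 2)" "x r = 1 + sqrt 2" "x s = - 1"
    using dist by (auto simp: x_def)
  have "laplacian_eigenfunction ?c x"
    unfolding laplacian_eigenfunction_def V using dist by (simp add: N x algebra_simps)
  moreover have "edge_pair_max G \<le> sqrt 2"
  proof (rule edge_pair_max_least)
    fix u v w assume "u \<rightarrow>\<^bsub>G\<^esub> v" "u \<rightarrow>\<^bsub>G\<^esub> w" "v \<noteq> w"
    then show "sqrt ((real (deg u) + real (deg v) - 2) * (real (deg u) + real (deg w) - 2)) \<le> sqrt 2"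
      using dist unfolding E by (elim insertE; simp add: D)
  qed simp
  ultimately show ?thesis by force
qed

section \<open>Graphs that attain the bound are extremal\<close>

text \<open>
  Along any walk the degrees alternate between \<open>deg u1\<close> and \<open>s - deg u1\<close>, in step with the
  bipartition.
\<close>

lemma semiregular_of_constant_edge_degree:
  assumes bip: "bipartition G V1 V2"
    and const: "\<And>u v. u \<in> V1 \<Longrightarrow> u \<rightarrow>\<^bsub>G\<^esub> v \<Longrightarrow> deg u + deg v = s"
  shows "semiregular_graph G"
proof -
  have V: "V1 \<union> V2 = verts G" "V1 \<inter> V2 = {}" using bip by (auto simp: bipartition_def)
  obtain u1 u2 where u: "u1 \<in> V1" "u2 \<in> V2" using bip by (auto simp: bipartition_def)
  then have uV: "u1 \<in> verts G" "u2 \<in> verts G" "u1 \<noteq> u2" using V by auto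
  then obtain v1 where "u1 \<rightarrow>\<^bsub>G\<^esub> v1" using ex_neighbour by metis
  then have le: "deg u1 \<le> s" using const u by fastforce
  let ?S = "{u \<in> V1. deg u = deg u1} \<union> {u \<in> V2. deg u = s - deg u1}"
  have "verts G \<subseteq> ?S"
  proof (rule verts_subset_closed)
    fix u v assume uS: "u \<in> ?S" and uv: "u \<rightarrow>\<^bsub>G\<^esub> v"
    show "v \<in> ?S"
    proof (cases "u \<in> V1")
      case True
      then have "v \<in> V2" "deg u = deg u1" "deg u + deg v = s"
        using bipartitionD[OF bip uv] uS V const uv by auto
      then show ?thesis by auto
    next
      case False
      then have "v \<in> V1" "deg u = s - deg u1" using bipartitionD[OF bip uv] uS by auto
      moreover have "deg v + deg u = s" using const[OF _ adj_sym[OF uv]] calculation by simp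
      ultimately show ?thesis using le by auto
    qed
  qed (use u uV in auto)
  then show ?thesis
    unfolding semiregular_graph_def using bip V by blast
qed

text \<open>
  All degrees are \<open>1\<close> or \<open>2\<close>, so a vertex of degree \<open>2\<close> has one neighbour of each degree.
  Apply this to the fork \<open>q\<close>: one neighbour \<open>p\<close> is a leaf and the other, \<open>r\<close>, has degree
  \<open>2\<close>.  Applied to \<open>r\<close>, whose neighbour \<open>q\<close> has degree \<open>2\<close>, it shows that the remaining
  neighbour \<open>s\<close> is a leaf, and \<open>p q r s\<close> is closed.
\<close>

lemma path_order_four_of_distinct_degrees:
  assumes le2: "\<And>u. u \<in> verts G \<Longrightarrow> deg u \<le> 2"
    and diff: "\<And>u v w. u \<rightarrow>\<^bsub>G\<^esub> v \<Longrightarrow> u \<rightarrow>\<^bsub>G\<^esub> w \<Longrightarrow> v \<noteq> w \<Longrightarrow> deg v \<noteq> deg w"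
    and fork: "q \<rightarrow>\<^bsub>G\<^esub> v" "q \<rightarrow>\<^bsub>G\<^esub> w" "v \<noteq> w"
  shows "path_order_four G"
proof -
  have one: "nbrs a = {b}" if "a \<rightarrow>\<^bsub>G\<^esub> b" "deg a = 1" for a b
  proof -
    have "card (nbrs a) = 1" using that out_degree_eq_card_nbrs by simp
    then obtain z where "nbrs a = {z}" by (rule card_1_singletonE)
    then show ?thesis using that by auto
  qed
  have two: "nbrs a = {b, c} \<and> deg a = 2" if "a \<rightarrow>\<^bsub>G\<^esub> b" "a \<rightarrow>\<^bsub>G\<^esub> c" "b \<noteq> c" for a b c
  proof -
    have sub: "{b, c} \<subseteq> nbrs a" using that by auto
    have "card (nbrs a) \<le> card {b, c}"
      using le2[OF adj_in_verts(1)[OF that(1)]] that(3) by (simp add: out_degree_eq_card_nbrs)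
    then have "{b, c} = nbrs a" using sub finite_nbrs by (metis card_seteq)
    then show ?thesis using that(3) by (metis card_2_iff out_degree_eq_card_nbrs)
  qed
  have small: "deg b = 1 \<or> deg b = 2" if "a \<rightarrow>\<^bsub>G\<^esub> b" for a b
    using out_degree_pos[OF adj_sym[OF that]] le2[OF adj_in_verts(2)[OF that]] by linarith
  obtain p r where pr: "q \<rightarrow>\<^bsub>G\<^esub> p" "q \<rightarrow>\<^bsub>G\<^esub> r" "p \<noteq> r" "deg p = 1" "deg r = 2"
    using fork small[OF fork(1)] small[OF fork(2)] diff[OF fork] that[of v w] that[of w v] by metis
  have rq: "r \<rightarrow>\<^bsub>G\<^esub> q" using adj_sym pr by blast
  have "nbrs r \<noteq> {q}" using pr(5) out_degree_eq_card_nbrs[of r] by auto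
  then obtain s where s: "r \<rightarrow>\<^bsub>G\<^esub> s" "s \<noteq> q" using rq by blast
  have Nq: "nbrs q = {p, r}" "deg q = 2" using two[OF pr(1-3)] by auto
  have Nr: "nbrs r = {q, s}" using two[OF rq s(1)] s by auto
  have Np: "nbrs p = {q}" using one[OF adj_sym[OF pr(1)] pr(4)] .
  have "deg s = 1" using small[OF s(1)] diff[OF s(1) rq s(2)] Nq by auto
  then have Ns: "nbrs s = {r}" using one[OF adj_sym[OF s(1)]] by auto
  have "r \<noteq> q" using rq adj_irrefl by auto
  then have "s \<noteq> p" using Np Ns by auto
  have dist: "distinct [p, q, r, s]"
    using pr(1-3) s \<open>r \<noteq> q\<close> \<open>s \<noteq> p\<close> adj_irrefl by auto
  have step: "v \<in> {p, q, r, s}" if "u \<in> {p, q, r, s}" "u \<rightarrow>\<^bsub>G\<^esub> v" for u v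
  proof -
    have "v \<in> nbrs u" using that by simp
    then show ?thesis using that(1) Np Nq(1) Nr Ns by auto
  qed
  have in_verts: "p \<in> verts G" "q \<in> verts G" "r \<in> verts G" "s \<in> verts G"
    using adj_in_verts pr(1,2) s(1) by blast+
  have V: "verts G = {p, q, r, s}"
    using verts_subset_closed[of q "{p, q, r, s}"] step in_verts by auto
  have "arcs_ends G = Sigma (verts G) nbrs" by (auto dest: adj_in_verts)
  also have "\<dots> = {(p, q), (q, p), (q, r), (r, q), (r, s), (s, r)}"
    unfolding V Sigma_def UN_insert Np Nq(1) Nr Ns by auto
  finally have "arcs_ends G = {(p, q), (q, p), (q, r), (r, q), (r, s), (s, r)}" .
  then show ?thesis unfolding path_order_four_def using dist V by metis
qed

definition alternating :: "('a \<times> 'a \<Rightarrow> real) \<Rightarrow> real \<Rightarrow> real \<Rightarrow> 'a \<times> 'a \<Rightarrow> bool" where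
  "alternating y a b g \<longleftrightarrow>
     y g = a \<and> (\<forall>f\<in>line_nbrs g. y f = b) \<or> y g = b \<and> (\<forall>f\<in>line_nbrs g. y f = a)"

text \<open>
  The property \<open>alternating y a b\<close> spreads from an arc to its line graph neighbours.
  \<open>V1\<close> and \<open>V2\<close> are the vertices all of whose leaving, respectively entering, arcs
  alternate; an arc with this property has its tail in \<open>V1\<close> and its head in \<open>V2\<close>, so these
  sets cover the connected graph.  They are disjoint because \<open>y\<close> is positive on alternating
  arcs and cannot be positive on both orientations of an edge.
\<close>

lemma equality_alternating:
  assumes x: "laplacian_eigenfunction (2 + edge_pair_max G) x" and M: "edge_pair_max G > 0"
  obtains V1 V2 a b where "bipartition G V1 V2" "a > 0" "b > 0"
    "\<And>u v. u \<in> V1 \<Longrightarrow> u \<rightarrow>\<^bsub>G\<^esub> v \<Longrightarrow> alternating (arc_diff x) a b (u, v)"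
proof -
  let ?y = "arc_diff x"
  obtain e where e: "e \<in> arcs_ends G" "?y e > 0"
    and max: "\<And>f. f \<in> arcs_ends G \<Longrightarrow> ?y f \<le> ?y e"
    using max_arc[OF x] M by auto
  define a where "a = ?y e"
  have tight: "\<exists>b>0. (\<forall>f\<in>line_nbrs g. ?y f = b) \<and> (\<forall>f\<in>line_nbrs g. \<forall>h\<in>line_nbrs f. ?y h = a)"
    if g: "g \<in> arcs_ends G" "?y g = a" for g
  proof -
    obtain b where "b > 0" "\<And>f. f \<in> line_nbrs g \<Longrightarrow> ?y f = b"
      "\<And>f h. f \<in> line_nbrs g \<Longrightarrow> h \<in> line_nbrs f \<Longrightarrow> ?y h = ?y g"
      by (rule neighbour_card_product_tight[of line_nbrs g "arcs_ends G" "edge_pair_max G" ?y])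
        (use finite_line_nbrs g line_nbrs_arcs arc_diff_eigen[OF x] M e max
          card_product_le_edge_pair_max[OF g(1)] in \<open>auto simp: a_def\<close>)
    then show ?thesis using g(2) by auto
  qed
  obtain b where b: "b > 0" "\<And>f. f \<in> line_nbrs e \<Longrightarrow> ?y f = b"
    using tight[OF e(1)] a_def by auto
  let ?alt = "alternating ?y a b"
  have step: "?alt f" if g: "g \<in> arcs_ends G" "?alt g" and f: "f \<in> line_nbrs g" for g f
  proof -
    have fA: "f \<in> arcs_ends G" using f line_nbrs_arcs[OF g(1)] by auto
    from g(2) show ?thesis unfolding alternating_def[of _ _ _ g]
    proof
      assume "?y g = a \<and> (\<forall>f\<in>line_nbrs g. ?y f = b)"
      then show ?thesis using tight[OF g(1)] f by (auto simp: alternating_def)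
    next
      assume *: "?y g = b \<and> (\<forall>f\<in>line_nbrs g. ?y f = a)"
      then obtain b' where "\<forall>h\<in>line_nbrs f. ?y h = b'" using tight[OF fA] f by auto
      moreover have "g \<in> line_nbrs f" using line_nbrs_sym[OF g(1) f] .
      ultimately show ?thesis using * f by (auto simp: alternating_def)
    qed
  qed
  have apos: "a > 0" using e a_def by simp
  have pos: "?y g > 0" if "?alt g" for g using that apos b by (auto simp: alternating_def)
  define V1 where "V1 = {u \<in> verts G. \<forall>w\<in>nbrs u. ?alt (u, w)}"
  define V2 where "V2 = {v \<in> verts G. \<forall>w\<in>nbrs v. ?alt (w, v)}"
  have tail: "u \<in> V1" and head: "v \<in> V2" if uv: "u \<rightarrow>\<^bsub>G\<^esub> v" and alt: "?alt (u, v)" for u v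
  proof -
    have "?alt (u, w)" if "u \<rightarrow>\<^bsub>G\<^esub> w" for w
      by (cases "w = v") (use alt step[OF uv alt, of "(u, w)"] that in auto)
    then show "u \<in> V1" using adj_in_verts(1)[OF uv] by (simp add: V1_def)
    have "?alt (w, v)" if "v \<rightarrow>\<^bsub>G\<^esub> w" for w
      by (cases "w = u") (use alt step[OF uv alt, of "(w, v)"] that in auto)
    then show "v \<in> V2" using adj_in_verts(2)[OF uv] by (simp add: V2_def)
  qed
  have V12: "v \<in> V2" if "u \<in> V1" "u \<rightarrow>\<^bsub>G\<^esub> v" for u v
    using that head by (auto simp: V1_def)
  have V21: "v \<in> V1" if "u \<in> V2" "u \<rightarrow>\<^bsub>G\<^esub> v" for u v
    using that tail adj_sym[OF that(2)] by (auto simp: V2_def)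
  obtain u0 v0 where uv0: "e = (u0, v0)" by fastforce
  have "?alt e" using b by (auto simp: alternating_def a_def)
  then have u0: "u0 \<in> V1" "v0 \<in> V2" "u0 \<noteq> v0" "u0 \<in> verts G" "v0 \<in> verts G"
    using tail head e(1) adj_irrefl adj_in_verts unfolding uv0 by auto
  have cover: "verts G \<subseteq> V1 \<union> V2"
    by (rule verts_subset_closed[of u0]) (use u0 V12 V21 in auto)
  have disj: "V1 \<inter> V2 = {}"
  proof (rule ccontr)
    assume "V1 \<inter> V2 \<noteq> {}"
    then obtain u where u: "u \<in> V1" "u \<in> V2" by auto
    then have "u \<in> verts G" by (simp add: V1_def)
    then obtain w where w: "u \<rightarrow>\<^bsub>G\<^esub> w" using u0 ex_neighbour by metis
    then have "?y (u, w) > 0" "?y (w, u) > 0" using u pos by (auto simp: V1_def V2_def)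
    then show False using arc_diff_flip[of x u w] by simp
  qed
  have "bipartition G V1 V2"
    unfolding bipartition_def
  proof (intro conjI)
    show "V1 \<noteq> {}" "V2 \<noteq> {}" using u0 by blast+
    show "V1 \<union> V2 = verts G" using cover by (auto simp: V1_def V2_def)
    show "\<forall>(u, v)\<in>arcs_ends G. u \<in> V1 \<and> v \<in> V2 \<or> u \<in> V2 \<and> v \<in> V1"
    proof (clarify)
      fix u v assume uv: "u \<rightarrow>\<^bsub>G\<^esub> v" and "\<not> (u \<in> V2 \<and> v \<in> V1)"
      moreover have "u \<in> V1 \<or> u \<in> V2" using cover adj_in_verts(1)[OF uv] by blast
      ultimately show "u \<in> V1 \<and> v \<in> V2" using V12[OF _ uv] V21[OF _ uv] by blast
    qed
  qed (rule disj)
  moreover have "?alt (u, v)" if "u \<in> V1" "u \<rightarrow>\<^bsub>G\<^esub> v" for u v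
    using that by (simp add: V1_def)
  ultimately show thesis using that apos b(1) by blast
qed

text \<open>
  If \<open>edge_pair_max G = 0\<close>, then no two edges meet and \<open>G\<close> is a single edge, for \<open>c = 2\<close>
  excludes the one-vertex graph.  Otherwise the two values of \<open>equality_alternating\<close>
  determine the degrees in the line graph.
\<close>

lemma equality_imp_extremal:
  assumes x: "laplacian_eigenfunction (2 + edge_pair_max G) x"
  shows "semiregular_graph G \<or> path_order_four G"
proof (cases "edge_pair_max G = 0")
  case True
  have "2 + edge_pair_max G \<noteq> 0" using True by simp
  then obtain e where e: "e \<in> arcs_ends G" using max_arc[OF x] by blast
  obtain p q where "e = (p, q)" by fastforce
  then have pq: "p \<rightarrow>\<^bsub>G\<^esub> q" using e by simp
  have single: "v = w" if "u \<rightarrow>\<^bsub>G\<^esub> v" "u \<rightarrow>\<^bsub>G\<^esub> w" for u v w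
  proof (rule ccontr)
    assume "v \<noteq> w"
    then have "card {v, w} \<le> deg u"
      unfolding out_degree_eq_card_nbrs using that by (intro card_mono finite_nbrs) auto
    then have "deg u \<ge> 2" "deg v \<ge> 1" "deg w \<ge> 1"
      using \<open>v \<noteq> w\<close> out_degree_pos[OF adj_sym[OF that(1)]] out_degree_pos[OF adj_sym[OF that(2)]] by auto
    then have "0 < sqrt ((real (deg u) + real (deg v) - 2) * (real (deg u) + real (deg w) - 2))"
      by simp
    then show False using edge_pair_max_upper[OF that \<open>v \<noteq> w\<close>] True by linarith
  qed
  have "p \<noteq> q" using pq adj_irrefl by auto
  have N: "nbrs p = {q}" "nbrs q = {p}" using single pq adj_sym[OF pq] by auto
  have "verts G \<subseteq> {p, q}"
    by (rule verts_subset_closed[of p]) (use N pq adj_in_verts in auto)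
  then have V: "verts G = {p, q}" using adj_in_verts[OF pq] by auto
  have "(u, v) = (p, q) \<or> (u, v) = (q, p)" if "u \<rightarrow>\<^bsub>G\<^esub> v" for u v
  proof -
    have "u \<in> {p, q}" "v \<in> nbrs u" using adj_in_verts[OF that] V that by auto
    then show ?thesis using N by auto
  qed
  then have "bipartition G {p} {q}"
    unfolding bipartition_def V using \<open>p \<noteq> q\<close> by auto
  then show ?thesis unfolding semiregular_graph_def by blast
next
  case False
  let ?M = "edge_pair_max G" and ?y = "arc_diff x"
  have M: "?M > 0" using False edge_pair_max_nonneg by linarith
  obtain V1 V2 a b where bip: "bipartition G V1 V2" and ab: "a > 0" "b > 0"
    and alt: "\<And>u v. u \<in> V1 \<Longrightarrow> u \<rightarrow>\<^bsub>G\<^esub> v \<Longrightarrow> alternating ?y a b (u, v)"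
    using equality_alternating[OF x M] by metis
  have V: "V1 \<union> V2 = verts G" "V1 \<inter> V2 = {}" using bip by (auto simp: bipartition_def)
  have size: "?y g = a \<and> ?M * a = real (card (line_nbrs g)) * b \<or>
      ?y g = b \<and> ?M * b = real (card (line_nbrs g)) * a"
    if "g \<in> arcs_ends G" "alternating ?y a b g" for g
    using arc_diff_eigen[OF x that(1)] that(2) by (auto simp: alternating_def)
  show ?thesis
  proof (cases "a = b")
    case True
    have "deg u + deg v = nat \<lceil>?M + 2\<rceil>" if "u \<in> V1" "u \<rightarrow>\<^bsub>G\<^esub> v" for u v
    proof -
      have "real (deg u) + real (deg v) - 2 = ?M"
        using size[OF that(2) alt[OF that]] True ab card_line_nbrs[OF that(2)] by auto
      then have "?M + 2 = real (deg u + deg v)" by simp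
      then show ?thesis by (metis ceiling_of_nat nat_int)
    qed
    then show ?thesis using semiregular_of_constant_edge_degree[OF bip] by blast
  next
    case ab_ne: False
    have vals: "?y g \<noteq> ?y f" if "alternating ?y a b g" "f \<in> line_nbrs g" for g f
      using that ab_ne by (auto simp: alternating_def)
    have cards: "card (line_nbrs g) \<noteq> card (line_nbrs f)"
      if g: "g \<in> arcs_ends G" "alternating ?y a b g"
        and f: "f \<in> arcs_ends G" "alternating ?y a b f" "f \<in> line_nbrs g" for g f
    proof
      let ?k = "real (card (line_nbrs g))"
      assume "card (line_nbrs g) = card (line_nbrs f)"
      then have "?M * a = ?k * b" "?M * b = ?k * a"
        using size[OF g] size[OF f(1,2)] vals[OF g(2) f(3)] by auto
      then have "(?M + ?k) * (a - b) = 0" by (simp add: algebra_simps)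
      then show False using M ab_ne by (simp add: add_pos_nonneg)
    qed
    have diff: "?y (u, v) \<noteq> ?y (u, w) \<and> deg v \<noteq> deg w"
      if "u \<in> V1" "u \<rightarrow>\<^bsub>G\<^esub> v" "u \<rightarrow>\<^bsub>G\<^esub> w" "v \<noteq> w" for u v w
    proof -
      have *: "alternating ?y a b (u, v)" "alternating ?y a b (u, w)" "(u, w) \<in> line_nbrs (u, v)"
        using alt[OF that(1,2)] alt[OF that(1,3)] that(3,4) by auto
      show ?thesis
        using vals[OF *(1,3)] cards[OF that(2) *(1) that(3) *(2,3)]
          card_line_nbrs[OF that(2)] card_line_nbrs[OF that(3)] by (metis of_nat_eq_iff)
    qed
    have diff': "?y (v, u) \<noteq> ?y (w, u) \<and> deg v \<noteq> deg w"
      if "u \<in> V2" "u \<rightarrow>\<^bsub>G\<^esub> v" "u \<rightarrow>\<^bsub>G\<^esub> w" "v \<noteq> w" for u v w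
    proof -
      have vw: "v \<rightarrow>\<^bsub>G\<^esub> u" "w \<rightarrow>\<^bsub>G\<^esub> u" using adj_sym that by auto
      have *: "alternating ?y a b (v, u)" "alternating ?y a b (w, u)" "(w, u) \<in> line_nbrs (v, u)"
        using alt[OF _ vw(1)] alt[OF _ vw(2)] bipartitionD(2)[OF bip that(2)]
          bipartitionD(2)[OF bip that(3)] that(1,3,4) by auto
      show ?thesis
        using vals[OF *(1,3)] cards[OF vw(1) *(1) vw(2) *(2,3)]
          card_line_nbrs[OF vw(1)] card_line_nbrs[OF vw(2)] by (metis of_nat_eq_iff)
    qed
    have in_ab: "?y (u, v) \<in> {a, b}" if "u \<in> V1" "u \<rightarrow>\<^bsub>G\<^esub> v" for u v
      using alt[OF that] by (auto simp: alternating_def)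
    have ab2: "card {a, b} \<le> 2" by (simp add: card_insert_if)
    have deg2: "deg u \<le> 2" if "u \<in> verts G" for u
    proof (cases "u \<in> V1")
      case True
      have "card (nbrs u) \<le> card {a, b}"
        by (rule card_inj_on_le[of "\<lambda>w. ?y (u, w)"])
          (use diff[OF True] in_ab[OF True] in \<open>auto simp: inj_on_def\<close>)
      then show ?thesis using ab2 by (simp add: out_degree_eq_card_nbrs)
    next
      case False
      then have u2: "u \<in> V2" using that V by auto
      have in_ab': "?y (w, u) \<in> {a, b}" if "u \<rightarrow>\<^bsub>G\<^esub> w" for w
        using in_ab[of w u] adj_sym[OF that] bipartitionD[OF bip that] u2 by auto
      have "card (nbrs u) \<le> card {a, b}"
        by (rule card_inj_on_le[of "\<lambda>w. ?y (w, u)"])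
          (use diff'[OF u2] in_ab' in \<open>auto simp: inj_on_def\<close>)
      then show ?thesis using ab2 by (simp add: out_degree_eq_card_nbrs)
    qed
    have deg_ne: "deg v \<noteq> deg w" if "u \<rightarrow>\<^bsub>G\<^esub> v" "u \<rightarrow>\<^bsub>G\<^esub> w" "v \<noteq> w" for u v w
    proof -
      have "u \<in> V1 \<or> u \<in> V2" using adj_in_verts(1)[OF that(1)] V by auto
      then show ?thesis using diff diff' that by blast
    qed
    have "\<exists>u v w. u \<rightarrow>\<^bsub>G\<^esub> v \<and> u \<rightarrow>\<^bsub>G\<^esub> w \<and> v \<noteq> w"
    proof (rule ccontr)
      assume "\<not> ?thesis"
      \<comment> \<open>Without a fork the maximum ranges over no pair of edges, so it has its default value.\<close>
      then have "edge_pair_max G \<le> 0" by (intro edge_pair_max_least) auto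
      then show False using M by simp
    qed
    then obtain q v w where qvw: "q \<rightarrow>\<^bsub>G\<^esub> v" "q \<rightarrow>\<^bsub>G\<^esub> w" "v \<noteq> w" by blast
    have "path_order_four G"
      by (rule path_order_four_of_distinct_degrees[OF _ _ qvw]) (fact deg2, fact deg_ne)
    then show ?thesis ..
  qed
qed

end

theorem theorem3p3:
  fixes G :: "('a, 'b) pre_digraph" and vs :: "'a list"
  assumes "graph G" and "Digraph_Component.connected G"
    and "distinct vs" and "set vs = verts G"
  shows "laplacian_lambda1 G vs \<le> 2 + edge_pair_max G \<and>
    (laplacian_lambda1 G vs = 2 + edge_pair_max G \<longleftrightarrow>
       (regular_graph G \<and> bipartite_graph G) \<or> semiregular_graph G \<or> path_order_four G)"
proof -
  interpret connected_graph G
    using assms(1,2) by (simp add: connected_graph_def connected_graph_axioms_def)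
  let ?l = "laplacian_lambda1 G vs"
  obtain x where x: "laplacian_eigenfunction ?l x"
    using laplacian_lambda1_greatest(1)[OF assms(3,4)] by blast
  then have le: "?l \<le> 2 + edge_pair_max G" by (rule eigenvalue_le_edge_pair_max)
  have "?l = 2 + edge_pair_max G \<longleftrightarrow> semiregular_graph G \<or> path_order_four G"
  proof
    assume "?l = 2 + edge_pair_max G"
    then show "semiregular_graph G \<or> path_order_four G" using equality_imp_extremal x by simp
  next
    assume "semiregular_graph G \<or> path_order_four G"
    then obtain c z where "laplacian_eigenfunction c z" "2 + edge_pair_max G \<le> c"
      using semiregular_attains path_order_four_attains by blast
    then have "2 + edge_pair_max G \<le> ?l"
      using laplacian_lambda1_greatest(2)[OF assms(3,4)] by fastforce
    then show "?l = 2 + edge_pair_max G" using le by simp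
  qed
  then show ?thesis using le regular_bipartite_imp_semiregular by blast
qed

end
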